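(* Let $\mathcal T$, $\mathcal C$ and $\mathcal A$ be respectively the sets of all, of connected, and of aperiodic two-step rules. The symmetric group $S_4$ acts on each of these sets by permuting the four step types, and the numbers of isomorphism classes (orbits) are $$N_{S_4}(\mathcal T)=3044,\qquad N_{S_4}(\mathcal C)=1168,\qquad N_{S_4}(\mathcal A)=1159.$$
   Context: The four step types on $\mathbb Z^2$ are east $(1,0)$, north $(0,1)$, west $(-1,0)$ and south $(0,-1)$, abbreviated $e,n,w,s$. A two-step rule is a map $R:\{e,n,w,s\}^2\to\{0,1\}$, where $R(i,j)=1$ means that a step of type $i$ may be immediately followed by a step of type $j$. Its transfer matrix $T$ is the $4\times4$ matrix with $T_{ij}=R(i,j)$, rows and columns ordered $e,n,w,s$. The rule is connected if for all $i,j$ there is $k\ge1$ with $(T^k)_{ij}>0$; it is aperiodic if there is a single $k\ge1$ with $(T^k)_{ij}>0$ for all $i,j$. A permutation $\pi$ of $\{e,n,w,s\}$ acts on rules by relabelling: $(\pi\cdot R)(\pi(i),\pi(j))=R(i,j)$. For a group $G$ acting on a set $X$ of rules, $N_G(X)$ denotes the number of orbits (isomorphism classes). *)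

theory Defs
  imports "HOL-Algebra.Group_Action" "Jordan_Normal_Form.Matrix"
begin

datatype step = East | North | West | South

text \<open>The values 0 and 1 of a two-step rule are rendered as \<^term>\<open>False\<close> and
  \<^term>\<open>True\<close>; the transfer matrix turns them back into numbers.\<close>

type_synonym rule2 = "step \<Rightarrow> step \<Rightarrow> bool"

definition transfer_matrix :: "rule2 \<Rightarrow> nat mat" where
  "transfer_matrix R =
    (let steps = [East, North, West, South]
     in mat 4 4 (\<lambda>(i, j). of_bool (R (steps ! i) (steps ! j))))"

definition connected_rule :: "rule2 \<Rightarrow> bool" where
  "connected_rule R \<longleftrightarrow>
    (\<forall>i<4. \<forall>j<4. \<exists>k\<ge>1. (transfer_matrix R ^\<^sub>m k) $$ (i, j) > 0)"

definition aperiodic_rule :: "rule2 \<Rightarrow> bool" where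
  "aperiodic_rule R \<longleftrightarrow>
    (\<exists>k\<ge>1. \<forall>i<4. \<forall>j<4. (transfer_matrix R ^\<^sub>m k) $$ (i, j) > 0)"

definition all_rules :: "rule2 set" where
  "all_rules = UNIV"

definition connected_rules :: "rule2 set" where
  "connected_rules = {R. connected_rule R}"

definition aperiodic_rules :: "rule2 set" where
  "aperiodic_rules = {R. aperiodic_rule R}"

abbreviation S4 :: "(step \<Rightarrow> step) monoid" where
  "S4 \<equiv> BijGroup UNIV"

definition relabel :: "(step \<Rightarrow> step) \<Rightarrow> rule2 \<Rightarrow> rule2" where
  "relabel \<pi> R = (\<lambda>i j. R (inv_into UNIV \<pi> i) (inv_into UNIV \<pi> j))"

lemma relabel_apply: "bij \<pi> \<Longrightarrow> relabel \<pi> R (\<pi> i) (\<pi> j) = R i j"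
  by (simp add: relabel_def bij_is_inj)

text \<open>The library's notion of a group action on \<open>X\<close> requires each group element to act
  by a function that is extensional on \<open>X\<close>, hence the restriction.\<close>

definition relabel_on :: "rule2 set \<Rightarrow> (step \<Rightarrow> step) \<Rightarrow> rule2 \<Rightarrow> rule2" where
  "relabel_on X \<pi> = restrict (relabel \<pi>) X"

definition num_classes :: "rule2 set \<Rightarrow> nat" where
  "num_classes X = card (orbits S4 X (relabel_on X))"

end

theory Submission
  imports Defs "HOL-Number_Theory.Cong"
begin

text \<open>By Burnside's lemma, 24 times the number of classes is the sum, over the 24 permutations
  \<open>g\<close> of the steps, of the number of rules fixed by \<open>g\<close>. A rule is a set of pairs of steps, its
  edges, and it is fixed by \<open>g\<close> iff this set is a union of cycles of \<open>g\<close> acting on pairs. So \<open>g\<close>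
  fixes \<open>2\<^sup>c\<close> rules, where \<open>c\<close> is the number of these cycles, and the sum over all \<open>g\<close> is
  \<open>73056 = 24 * 3044\<close>.

  For the other two sets, connectedness and aperiodicity are reduced to conditions on single
  edges. The powers of the transfer matrix have positive entries exactly where walks of the
  given length exist. Hence a rule is connected iff every nonempty proper subset of the steps is
  left by some edge (\<open>strongly_connected_iff_no_closed_subset\<close>), and a connected rule fails to be
  aperiodic iff its steps can be coloured by the residues modulo a prime \<open>p\<close> such that every edge
  raises the colour by one (\<open>primitive_iff_no_cyclic_colouring\<close>). All \<open>p\<close> colours are then used,
  so \<open>p\<close> is 2 or 3. The second equivalence is the classical fact about periods: the lengths of
  closed walks at a point are closed under addition, and such a set of numbers contains all
  large numbers unless a prime divides all of its elements (\<open>additive_set_cofinite\<close>).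

  In this form the fixed rules can be counted by choosing the cycles one by one while recording
  which subsets are not yet left and which colourings are still possible. Evaluation of this
  recursion over all \<open>g\<close> gives \<open>28032 = 24 * 1168\<close> fixed connected rules, of which
  \<open>216 = 24 * 9\<close> are periodic, and \<open>1168 - 9 = 1159\<close>.\<close>

section \<open>Additively closed sets of natural numbers\<close>

lemma additive_set_contains_multiples:
  fixes L :: "nat set"
  assumes add: "\<And>x y. x \<in> L \<Longrightarrow> y \<in> L \<Longrightarrow> x + y \<in> L" and "x \<in> L" "y \<in> L"
  shows "x + k * y \<in> L"
proof (induction k)
  case 0
  then show ?case using assms by simp
next
  case (Suc k)
  then have "(x + k * y) + y \<in> L"
    using add assms(3) by blast
  then show ?case by (simp add: algebra_simps)
qed

text \<open>The differences of elements of \<open>L\<close> behave like a group: the least positive one,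
  \<open>d\<close>, divides every element of \<open>L\<close>, since a nonzero remainder would be a smaller difference.
  As no prime divides all of \<open>L\<close>, this forces \<open>d = 1\<close>, so \<open>L\<close> contains consecutive numbers
  \<open>a\<close> and \<open>a + 1\<close>, whose combinations cover everything beyond \<open>a\<^sup>2\<close>.\<close>

lemma additive_set_cofinite:
  fixes L :: "nat set"
  assumes add: "\<And>x y. x \<in> L \<Longrightarrow> y \<in> L \<Longrightarrow> x + y \<in> L"
    and ne: "l\<^sub>0 \<in> L" "0 < l\<^sub>0"
    and no_prime: "\<And>p. prime p \<Longrightarrow> \<exists>l\<in>L. \<not> p dvd l"
  shows "\<exists>N. \<forall>n\<ge>N. n \<in> L"
proof -
  have multiples: "x + k * y \<in> L" if "x \<in> L" "y \<in> L" for x y k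
    using additive_set_contains_multiples[of L] add that by blast
  define D where "D d \<longleftrightarrow> 0 < d \<and> (\<exists>a\<in>L. a + d \<in> L)" for d
  define d where "d = (LEAST d. D d)"
  have "D l\<^sub>0"
    unfolding D_def using ne add by blast
  then have "D d"
    unfolding d_def by (rule LeastI)
  then obtain a where d: "0 < d" "a \<in> L" "a + d \<in> L"
    unfolding D_def by blast
  have dvd: "d dvd l" if "l \<in> L" for l
  proof (rule ccontr)
    assume "\<not> d dvd l"
    define q r where "q = l div d" and "r = l mod d"
    have r: "0 < r" "r < d" and l: "l = q * d + r"
      using \<open>\<not> d dvd l\<close> d(1) by (auto simp: q_def r_def mod_greater_zero_iff_not_dvd)
    \<comment> \<open>Shifting \<open>l\<close> and \<open>q * d\<close> by \<open>Suc q * a\<close> turns both into elements of \<open>L\<close>, so that \<open>r\<close>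
      is again a difference; the extra \<open>a\<close> keeps them in \<open>L\<close> when \<open>q = 0\<close>, as \<open>L\<close> may
      lack \<open>0\<close>.\<close>
    have "a + q * (a + d) \<in> L" "l + Suc q * a \<in> L"
      using multiples[of a "a + d" q] multiples[of l a "Suc q"] d that by auto
    moreover have "l + Suc q * a = (a + q * (a + d)) + r"
      by (simp add: l algebra_simps)
    ultimately have "(a + q * (a + d)) + r \<in> L"
      by metis
    then have "D r"
      unfolding D_def using r(1) \<open>a + q * (a + d) \<in> L\<close> by blast
    then show False
      using r(2) not_less_Least unfolding d_def by blast
  qed
  have "d = 1"
  proof (rule ccontr)
    assume "d \<noteq> 1"
    then obtain p where "prime p" "p dvd d"
      using prime_factor_nat by blast
    then show False
      using no_prime dvd dvd_trans by blast
  qed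
  then have a: "a \<in> L" "a + 1 \<in> L"
    using d by auto
  have "n \<in> L" if n: "a * a + 1 \<le> n" for n
  proof (cases "a = 0")
    case True
    then show ?thesis
      using multiples[OF a(2) a(2), of "n - 1"] n by simp
  next
    case False
    define q r where "q = n div a" and "r = n mod a"
    have "r < a" "a \<le> q"
      using False n by (auto simp: q_def r_def less_eq_div_iff_mult_less_eq)
    then obtain t where t: "q = Suc t + r"
      by (intro that[of "q - r - 1"]) simp
    have "n = q * a + r"
      by (simp add: q_def r_def)
    also have "\<dots> = (a + t * a) + r * (a + 1)"
      by (simp add: t algebra_simps)
    also have "\<dots> \<in> L"
      using multiples a by blast
    finally show ?thesis .
  qed
  then show ?thesis
    by blast
qed

section \<open>Strongly connected and primitive relations\<close>

definition strongly_connected :: "('a \<Rightarrow> 'a \<Rightarrow> bool) \<Rightarrow> bool" where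
  "strongly_connected R \<longleftrightarrow> (\<forall>x y. \<exists>k\<ge>1. (R ^^ k) x y)"

definition primitive_rel :: "('a \<Rightarrow> 'a \<Rightarrow> bool) \<Rightarrow> bool" where
  "primitive_rel R \<longleftrightarrow> (\<exists>k\<ge>1. \<forall>x y. (R ^^ k) x y)"

text \<open>For a strongly connected relation, such a colouring with \<open>p\<close> colours exists exactly when
  \<open>p\<close> divides its period, the greatest common divisor of the lengths of its closed walks.\<close>

definition cyclic_colouring :: "nat \<Rightarrow> ('a \<Rightarrow> nat) \<Rightarrow> ('a \<Rightarrow> 'a \<Rightarrow> bool) \<Rightarrow> bool" where
  "cyclic_colouring p c R \<longleftrightarrow>
    (\<forall>x. c x < p) \<and> (\<forall>x y. R x y \<longrightarrow> c y = Suc (c x) mod p)"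

lemma strongly_connected_successor:
  "strongly_connected R \<Longrightarrow> \<exists>y. R x y"
  unfolding strongly_connected_def
  by (metis One_nat_def Suc_le_D relpowp_Suc_E2)

text \<open>The set of points reachable from \<open>x\<close> by a nonempty walk has no edge leaving it. With at
  least two points, \<open>{x}\<close> is itself a proper subset, so that this set is nonempty, and it is
  then everything. On a single point the right-hand side would be vacuous even without a
  loop.\<close>

lemma strongly_connected_iff_no_closed_subset:
  fixes R :: "'a \<Rightarrow> 'a \<Rightarrow> bool"
  assumes "\<And>x :: 'a. UNIV \<noteq> {x}"
  shows "strongly_connected R \<longleftrightarrow>
    (\<forall>A. A \<noteq> {} \<longrightarrow> A \<noteq> UNIV \<longrightarrow> (\<exists>x y. R x y \<and> x \<in> A \<and> y \<notin> A))"
    (is "_ \<longleftrightarrow> ?cuts")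
proof
  assume conn: "strongly_connected R"
  show ?cuts
  proof (intro allI impI, rule ccontr)
    fix A :: "'a set"
    assume "A \<noteq> {}" "A \<noteq> UNIV" and closed: "\<nexists>x y. R x y \<and> x \<in> A \<and> y \<notin> A"
    then obtain x y k where "x \<in> A" "y \<notin> A" "(R ^^ k) x y"
      using conn unfolding strongly_connected_def by blast
    moreover have "(R ^^ k) x y \<Longrightarrow> y \<in> A" for k y
      using \<open>x \<in> A\<close> closed by (induction k arbitrary: y) auto
    ultimately show False by blast
  qed
next
  assume cuts: ?cuts
  have "{z. \<exists>k\<ge>1. (R ^^ k) x z} = UNIV" (is "?A = UNIV") for x
  proof (rule ccontr)
    assume notall: "?A \<noteq> UNIV"
    obtain y where "R x y"
      using cuts assms[of x] by blast
    then have "y \<in> ?A"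
      by (auto intro!: exI[of _ 1])
    then have "?A \<noteq> {}"
      by blast
    then obtain u v where uv: "R u v" "u \<in> ?A" "v \<notin> ?A"
      using cuts notall by meson
    then obtain k where "(R ^^ Suc k) x v"
      using relpowp_Suc_I by fast
    then show False
      using uv(3) by fastforce
  qed
  then show "strongly_connected R"
    unfolding strongly_connected_def by blast
qed

lemma cyclic_colouring_walk:
  assumes "cyclic_colouring p c R" "(R ^^ k) x y"
  shows "c y = (c x + k) mod p"
  using assms(2)
proof (induction k arbitrary: y)
  case 0
  then show ?case
    using assms(1) by (simp add: cyclic_colouring_def)
next
  case (Suc k)
  then obtain z where "c z = (c x + k) mod p" "R z y"
    by auto
  then show ?case
    using assms(1) by (simp add: cyclic_colouring_def mod_Suc_eq)
qed

text \<open>Every point has a successor, so walks of every length start at \<open>x\<close>, and the colour of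
  their end points runs through all residues. The number of colours is thereby bounded by the
  number of points.\<close>

lemma cyclic_colouring_surj:
  assumes conn: "strongly_connected R" and col: "cyclic_colouring p c R"
  shows "{..<p} \<subseteq> range c"
proof
  fix i
  assume "i \<in> {..<p}"
  fix x
  have "\<exists>y. (R ^^ k) x y" for k
  proof (induction k)
    case (Suc k)
    then show ?case
      using strongly_connected_successor[OF conn] by (meson relpowp_Suc_I)
  qed (auto intro: relpowp_0_I)
  \<comment> \<open>The length is chosen so that the walk ends in colour \<open>i\<close>.\<close>
  then obtain y where "(R ^^ (i + (p - c x))) x y"
    by blast
  then have "c y = (c x + (i + (p - c x))) mod p"
    using cyclic_colouring_walk[OF col] by blast
  also have "c x + (i + (p - c x)) = i + p"
    using col less_imp_le[of "c x" p] by (simp add: cyclic_colouring_def)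
  finally have "c y = i"
    using \<open>i \<in> {..<p}\<close> by simp
  then show "i \<in> range c" by blast
qed

text \<open>The colour of \<open>x\<close> is the length, modulo \<open>p\<close>, of any walk from \<open>a\<close> to \<open>x\<close>. Two such walks can
  be closed up by one and the same walk back to \<open>a\<close>, hence their lengths are congruent.\<close>

lemma cyclic_colouring_exists:
  assumes conn: "strongly_connected R" and p: "0 < p"
    and dvd: "\<And>k. (R ^^ k) a a \<Longrightarrow> p dvd k"
  obtains c where "cyclic_colouring p c R"
proof -
  have eq: "k mod p = k' mod p" if "(R ^^ k) a x" "(R ^^ k') a x" for k k' x
  proof -
    obtain m where "(R ^^ m) x a"
      using conn unfolding strongly_connected_def by blast
    then have "p dvd k + m" "p dvd k' + m"
      using that dvd relpowp_trans by metis+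
    then have "(k + m) mod p = (k' + m) mod p"
      by (simp add: mod_eq_0_iff_dvd)
    then show ?thesis
      using cong_add_rcancel_nat unfolding cong_def by blast
  qed
  define len where "len x = (SOME k. (R ^^ k) a x)" for x
  have len: "(R ^^ len x) a x" for x
    unfolding len_def using conn unfolding strongly_connected_def by (metis someI_ex)
  have "cyclic_colouring p (\<lambda>x. len x mod p) R"
    unfolding cyclic_colouring_def
  proof (intro conjI allI impI)
    fix x y
    assume "R x y"
    then have "(R ^^ Suc (len x)) a y"
      using len relpowp_Suc_I by metis
    then have "len y mod p = Suc (len x) mod p"
      using eq len by blast
    then show "len y mod p = Suc (len x mod p) mod p"
      by (simp add: mod_Suc_eq)
  qed (use p in auto)
  then show thesis
    using that by blast
qed

text \<open>A colouring prevents walks of one common length from joining \<open>x\<close> to points of two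
  different colours. Conversely, if no prime admits a colouring, then no prime divides all the
  lengths of closed walks at a point \<open>a\<close>, so all large lengths occur there. A walk from \<open>x\<close> to
  \<open>a\<close> and one from \<open>a\<close> to \<open>y\<close> then leave room to adjust the total length to a common value.\<close>

theorem primitive_iff_no_cyclic_colouring:
  fixes R :: "'a::finite \<Rightarrow> 'a \<Rightarrow> bool"
  shows "primitive_rel R \<longleftrightarrow> strongly_connected R \<and>
    \<not> (\<exists>p c. prime p \<and> p \<le> card (UNIV :: 'a set) \<and> cyclic_colouring p c R)"
proof
  assume "primitive_rel R"
  then obtain k where k: "1 \<le> k" "\<And>x y. (R ^^ k) x y"
    unfolding primitive_rel_def by blast
  then have conn: "strongly_connected R"
    unfolding strongly_connected_def by blast
  have False if "prime p" and col: "cyclic_colouring p c R" for p c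
  proof -
    have "2 \<le> p"
      using \<open>prime p\<close> by (rule prime_ge_2_nat)
    then have "0 \<in> range c" "1 \<in> range c"
      using cyclic_colouring_surj[OF conn col] by auto
    then obtain x y where "c x = 0" "c y = 1"
      by auto
    then show False
      using cyclic_colouring_walk[OF col k(2)[of x x]]
        cyclic_colouring_walk[OF col k(2)[of x y]] by simp
  qed
  then show "strongly_connected R \<and>
      \<not> (\<exists>p c. prime p \<and> p \<le> card (UNIV :: 'a set) \<and> cyclic_colouring p c R)"
    using conn by blast
next
  assume *: "strongly_connected R \<and>
      \<not> (\<exists>p c. prime p \<and> p \<le> card (UNIV :: 'a set) \<and> cyclic_colouring p c R)"
  then have conn: "strongly_connected R" by blast
  fix a :: 'a
  define L where "L = {k. (R ^^ k) a a}"
  have add: "\<And>k l. k \<in> L \<Longrightarrow> l \<in> L \<Longrightarrow> k + l \<in> L"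
    unfolding L_def using relpowp_trans by fastforce
  obtain l\<^sub>0 where l\<^sub>0: "l\<^sub>0 \<in> L" "0 < l\<^sub>0"
    using conn unfolding strongly_connected_def L_def
    by (metis less_eq_Suc_le mem_Collect_eq One_nat_def)
  have "\<exists>l\<in>L. \<not> p dvd l" if "prime p" for p
  proof (rule ccontr)
    assume "\<not> (\<exists>l\<in>L. \<not> p dvd l)"
    then have "\<And>k. (R ^^ k) a a \<Longrightarrow> p dvd k"
      unfolding L_def by blast
    then obtain c where c: "cyclic_colouring p c R"
      using cyclic_colouring_exists[OF conn] prime_gt_0_nat[OF \<open>prime p\<close>] by metis
    have "card {..<p} \<le> card (range c)"
      by (intro card_mono cyclic_colouring_surj[OF conn c]) simp
    also have "\<dots> \<le> card (UNIV :: 'a set)"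
      by (rule card_image_le) simp
    finally show False
      using * c \<open>prime p\<close> by auto
  qed
  with add l\<^sub>0 have "\<exists>N. \<forall>n\<ge>N. n \<in> L"
    by (rule additive_set_cofinite)
  then obtain N where N: "\<And>n. N \<le> n \<Longrightarrow> n \<in> L"
    by blast
  have "\<forall>x. \<exists>k. (R ^^ k) x a" "\<forall>y. \<exists>k. (R ^^ k) a y"
    using conn unfolding strongly_connected_def by blast+
  then obtain u v where u: "\<And>x. (R ^^ u x) x a" and v: "\<And>y. (R ^^ v y) a y"
    by metis
  \<comment> \<open>Large enough to leave at least \<open>N\<close> steps for the closed walk at \<open>a\<close>, whatever the end
    points.\<close>
  define k where "k = Suc N + (\<Sum>x\<in>UNIV. u x) + (\<Sum>y\<in>UNIV. v y)"
  have "(R ^^ k) x y" for x y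
  proof -
    have "u x \<le> (\<Sum>x\<in>UNIV. u x)" "v y \<le> (\<Sum>y\<in>UNIV. v y)"
      by (simp_all add: member_le_sum)
    then obtain n where n: "N \<le> n" "k = u x + n + v y"
      by (intro that[of "k - u x - v y"]) (auto simp: k_def)
    have "(R ^^ (u x + n + v y)) x y"
      using N[OF n(1)] unfolding L_def
      by (intro relpowp_trans[OF relpowp_trans[OF u _] v]) simp
    then show ?thesis
      by (simp add: n)
  qed
  moreover have "1 \<le> k"
    by (simp add: k_def)
  ultimately show "primitive_rel R"
    unfolding primitive_rel_def by blast
qed
section \<open>Transfer matrices count walks\<close>

definition steps :: "step list" where
  "steps = [East, North, West, South]"

lemma set_steps: "set steps = UNIV"
  unfolding steps_def by (auto intro: step.exhaust)

instance step :: finite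
  by standard (simp flip: set_steps)

lemma length_steps: "length steps = 4" and distinct_steps: "distinct steps"
  by (simp_all add: steps_def)

lemma card_step: "card (UNIV :: step set) = 4"
  unfolding set_steps[symmetric] by (simp add: steps_def)

lemma all_step_iff_nth: "(\<forall>x. P x) \<longleftrightarrow> (\<forall>i<4. P (steps ! i))"
  using all_set_conv_all_nth[of steps P] by (simp add: set_steps length_steps)

text \<open>A power of a nonnegative matrix has a positive entry exactly where a walk of that length
  exists, because a sum of natural numbers is positive iff one of its terms is.\<close>

lemma pow_transfer_matrix_pos_iff:
  assumes "i < 4" "j < 4"
  shows "0 < (transfer_matrix R ^\<^sub>m k) $$ (i, j) \<longleftrightarrow> (R ^^ k) (steps ! i) (steps ! j)"
  using assms(2)
proof (induction k arbitrary: j)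
  let ?T = "transfer_matrix R"
  have T: "?T \<in> carrier_mat 4 4"
    by (simp add: transfer_matrix_def Let_def)
  {
    case 0
    show ?case
      using T assms(1) 0 by (auto simp: nth_eq_iff_index_eq distinct_steps length_steps)
  next
    case (Suc k)
    have "(?T ^\<^sub>m Suc k) $$ (i, j) = (\<Sum>l<4. (?T ^\<^sub>m k) $$ (i, l) * ?T $$ (l, j))"
      using T assms(1) Suc.prems by (simp add: scalar_prod_def lessThan_atLeast0)
    then have "0 < (?T ^\<^sub>m Suc k) $$ (i, j) \<longleftrightarrow>
        (\<exists>l<4. 0 < (?T ^\<^sub>m k) $$ (i, l) \<and> 0 < ?T $$ (l, j))"
      by (simp only: neq0_conv[symmetric] sum_eq_0_iff finite_lessThan) auto
    also have "\<dots> \<longleftrightarrow> (\<exists>l<4. (R ^^ k) (steps ! i) (steps ! l) \<and> R (steps ! l) (steps ! j))"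
      using Suc by (auto simp: transfer_matrix_def Let_def steps_def)
    also have "\<dots> \<longleftrightarrow> (R ^^ Suc k) (steps ! i) (steps ! j)"
      using all_step_iff_nth[of "\<lambda>z. \<not> ((R ^^ k) (steps ! i) z \<and> R z (steps ! j))"] by auto
    finally show ?case .
  }
qed

lemma connected_rule_iff: "connected_rule R \<longleftrightarrow> strongly_connected R"
  unfolding connected_rule_def strongly_connected_def
  by (simp add: pow_transfer_matrix_pos_iff all_step_iff_nth cong: conj_cong)

lemma aperiodic_rule_iff: "aperiodic_rule R \<longleftrightarrow> primitive_rel R"
  unfolding aperiodic_rule_def primitive_rel_def
  by (simp add: pow_transfer_matrix_pos_iff all_step_iff_nth cong: conj_cong)

section \<open>The action of the symmetric group\<close>

text \<open>Relabelling commutes with composition of relations, so connectedness and aperiodicity,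
  which only speak about the powers of a rule, are invariant under it.\<close>

lemma relabel_relpowp:
  assumes "bij g"
  shows "relabel g R ^^ k = relabel g (R ^^ k)"
proof (induction k)
  case 0
  have "inv_into UNIV g x = inv_into UNIV g y \<longleftrightarrow> x = y" for x y
    using assms by (metis bij_inv_eq_iff)
  then show ?case
    by (simp add: relabel_def fun_eq_iff)
next
  case (Suc k)
  have "(\<exists>z. P (inv_into UNIV g z)) \<longleftrightarrow> (\<exists>z. P z)" for P
    using assms by (metis bij_inv_eq_iff)
  note ex_inv = this
  show ?case
  proof (intro ext)
    fix x y
    have "(relabel g R ^^ Suc k) x y \<longleftrightarrow> (\<exists>z. relabel g (R ^^ k) x z \<and> relabel g R z y)"
      by (simp add: Suc.IH OO_def)
    also have "\<dots> \<longleftrightarrow> relabel g (R ^^ Suc k) x y"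
      unfolding relabel_def relpowp.simps OO_def by (rule ex_inv)
    finally show "(relabel g R ^^ Suc k) x y \<longleftrightarrow> relabel g (R ^^ Suc k) x y" .
  qed
qed

lemma strongly_connected_relabel:
  assumes "bij g" "strongly_connected R"
  shows "strongly_connected (relabel g R)"
  using assms(2) unfolding strongly_connected_def relabel_relpowp[OF assms(1)]
  by (simp add: relabel_def)

lemma primitive_relabel:
  assumes "bij g" "primitive_rel R"
  shows "primitive_rel (relabel g R)"
proof -
  obtain k where "1 \<le> k" "\<And>x y. (R ^^ k) x y"
    using assms(2) unfolding primitive_rel_def by blast
  then show ?thesis
    unfolding primitive_rel_def
    by (intro exI[of _ k]) (simp add: relabel_relpowp[OF assms(1)] relabel_def[of g "R ^^ k"])
qed

lemma relabel_comp:
  "bij g \<Longrightarrow> bij h \<Longrightarrow> relabel (g \<circ> h) R = relabel g (relabel h R)"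
  by (simp add: relabel_def o_inv_distrib)

lemma relabel_inverse:
  assumes "bij g"
  shows "relabel (inv_into UNIV g) (relabel g R) = R" "relabel g (relabel (inv_into UNIV g) R) = R"
  using assms
  by (simp_all add: relabel_def inv_inv_eq bij_is_inj bij_is_surj surj_f_inv_f)

lemma Bij_UNIV: "Bij UNIV = {g. bij g}"
  by (simp add: Bij_def)

lemma group_action_relabel:
  assumes closed: "\<And>g R. bij g \<Longrightarrow> R \<in> X \<Longrightarrow> relabel g R \<in> X"
  shows "group_action S4 X (relabel_on X)"
proof -
  have Bij: "relabel_on X g \<in> Bij X" if "bij g" for g
  proof -
    have "bij (inv_into UNIV g)"
      using that by (rule bij_imp_bij_inv)
    then have "bij_betw (relabel g) X X"
      using that closed
      by (intro bij_betw_byWitness[where f' = "relabel (inv_into UNIV g)"])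
        (auto simp: relabel_inverse)
    then show ?thesis
      by (simp add: relabel_on_def Bij_def cong: bij_betw_cong)
  qed
  have "relabel_on X \<in> hom S4 (BijGroup X)"
  proof (rule homI)
    fix g h
    assume "g \<in> carrier S4" "h \<in> carrier S4"
    then have gh: "bij g" "bij h"
      by (simp_all add: BijGroup_def Bij_UNIV)
    then have "relabel_on X (g \<circ> h) = compose X (relabel_on X g) (relabel_on X h)"
      using closed by (auto simp: relabel_on_def compose_def fun_eq_iff relabel_comp)
    then show "relabel_on X (g \<otimes>\<^bsub>S4\<^esub> h) = relabel_on X g \<otimes>\<^bsub>BijGroup X\<^esub> relabel_on X h"
      using gh Bij by (simp add: BijGroup_def Bij_UNIV compose_def comp_def restrict_UNIV)
  qed (use Bij in \<open>auto simp: BijGroup_def Bij_UNIV\<close>)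
  then show ?thesis
    unfolding group_action_def group_hom_def group_hom_axioms_def
    by (simp add: group_BijGroup)
qed

lemma group_action_all: "group_action S4 all_rules (relabel_on all_rules)"
  by (rule group_action_relabel) (simp add: all_rules_def)

lemma group_action_connected: "group_action S4 connected_rules (relabel_on connected_rules)"
  by (rule group_action_relabel)
    (simp add: connected_rules_def connected_rule_iff strongly_connected_relabel)

lemma group_action_aperiodic: "group_action S4 aperiodic_rules (relabel_on aperiodic_rules)"
  by (rule group_action_relabel)
    (simp add: aperiodic_rules_def aperiodic_rule_iff primitive_relabel)

section \<open>Burnside's lemma over an explicit list of permutations\<close>

text \<open>Functions given by their lists of values can be enumerated by evaluation; both the
  permutations and the colourings of the steps are listed in this way.\<close>

fun step_table :: "'b list \<Rightarrow> step \<Rightarrow> 'b" where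
  "step_table xs East = xs ! 0"
| "step_table xs North = xs ! 1"
| "step_table xs West = xs ! 2"
| "step_table xs South = xs ! 3"

lemma step_table_map_steps: "step_table (map f steps) = f"
proof
  show "step_table (map f steps) x = f x" for x
    by (cases x) (simp_all add: steps_def)
qed

lemma map_step_table_steps: "length xs = 4 \<Longrightarrow> map (step_table xs) steps = xs"
  by (rule nth_equalityI) (auto simp: steps_def less_Suc_eq numeral_eq_Suc)

definition perms :: "step list list" where
  "perms = filter distinct (List.n_lists 4 steps)"

lemma set_perms: "set perms = {xs. length xs = 4 \<and> distinct xs}"
  by (auto simp: perms_def set_n_lists set_steps)

lemma length_perms: "length perms = 24"
  by code_simp

lemma distinct_perms: "distinct perms"
  by (auto simp: perms_def steps_def intro!: distinct_filter distinct_n_lists)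

lemma bij_betw_step_table_perms: "bij_betw step_table (set perms) (Bij UNIV)"
proof (rule bij_betw_byWitness[where f' = "\<lambda>g. map g steps"])
  show "(\<lambda>g. map g steps) ` Bij UNIV \<subseteq> set perms"
    using length_steps distinct_steps
    by (auto simp: set_perms Bij_UNIV distinct_map bij_is_inj inj_on_subset[OF bij_is_inj])
  show "step_table ` set perms \<subseteq> Bij UNIV"
  proof safe
    fix xs
    assume "xs \<in> set perms"
    then have "distinct (map (step_table xs) steps)"
      by (simp add: set_perms map_step_table_steps)
    then have "inj (step_table xs)"
      by (simp add: distinct_map set_steps)
    then show "step_table xs \<in> Bij UNIV"
      by (simp add: Bij_UNIV bij_def finite_UNIV_inj_surj)
  qed
qed (simp_all add: set_perms map_step_table_steps step_table_map_steps)

lemma num_classes_burnside: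
  assumes "group_action S4 X (relabel_on X)"
  shows "24 * int (num_classes X) =
    (\<Sum>xs\<leftarrow>perms. int (card {R \<in> X. relabel (step_table xs) R = R}))"
proof -
  interpret group_action S4 X "relabel_on X"
    by fact
  have carrier: "carrier S4 = Bij UNIV"
    by (simp add: BijGroup_def)
  have "order S4 = 24"
    using bij_betw_same_card[OF bij_betw_step_table_perms] distinct_card[OF distinct_perms]
    by (simp add: order_def carrier length_perms)
  then have "num_classes X * 24 = (\<Sum>g\<in>Bij UNIV. card (invariants X (relabel_on X) g))"
    using burnside unfolding num_classes_def carrier by (simp add: Bij_UNIV)
  also have "\<dots> = (\<Sum>g\<in>Bij UNIV. card {R \<in> X. relabel g R = R})"
    by (simp add: invariants_def relabel_on_def cong: conj_cong)
  also have "\<dots> = (\<Sum>xs\<in>set perms. card {R \<in> X. relabel (step_table xs) R = R})"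
    by (rule sum.reindex_bij_betw[OF bij_betw_step_table_perms, symmetric])
  also have "\<dots> = (\<Sum>xs\<leftarrow>perms. card {R \<in> X. relabel (step_table xs) R = R})"
    by (rule sum.distinct_set_conv_list[OF distinct_perms])
  finally have "int (num_classes X * 24) = \<dots>"
    by (rule arg_cong)
  then show ?thesis
    by (simp add: comp_def flip: sum_list_of_nat)
qed

section \<open>Fixed rules are unions of cycles of pairs\<close>

text \<open>A list \<open>b\<close> without repetitions is a cycle of \<open>f\<close>, written in the order in which \<open>f\<close> visits
  its elements, exactly when applying \<open>f\<close> to it amounts to rotating it.\<close>

definition cycle_decomposition :: "('a \<Rightarrow> 'a) \<Rightarrow> 'a list list \<Rightarrow> bool" where
  "cycle_decomposition f bs \<longleftrightarrow> distinct (concat bs) \<and> [] \<notin> set bs \<and>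
    (\<forall>x. x \<in> set (concat bs)) \<and> (\<forall>b\<in>set bs. map f b = rotate1 b)"

lemma invariant_set_contains_cycle:
  assumes cyc: "map f b = rotate1 b" and inv: "\<And>x. f x \<in> X \<longleftrightarrow> x \<in> X"
    and "x \<in> set b" "x \<in> X"
  shows "set b \<subseteq> X"
proof -
  have *: "b ! i \<in> X \<longleftrightarrow> b ! 0 \<in> X" if "i < length b" for i
    using that
  proof (induction i)
    case (Suc i)
    then have "f (b ! i) = b ! Suc i"
      using arg_cong[OF cyc, of "\<lambda>c. c ! i"] by (simp add: nth_rotate1)
    then show ?case
      using Suc inv by (metis Suc_lessD)
  qed simp
  show ?thesis
    using * assms(3,4) by (metis in_set_conv_nth subsetI)
qed

text \<open>An invariant set contains or avoids each cycle as a whole, so choosing an invariant set is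
  choosing a sublist of the list of cycles.\<close>

lemma set_unions_of_cycles:
  assumes "cycle_decomposition f bs"
  shows "(\<lambda>S. set (concat S)) ` set (subseqs bs) = {X. \<forall>x. f x \<in> X \<longleftrightarrow> x \<in> X}"
proof -
  have "distinct (concat bs)" and cover: "\<And>x. \<exists>b\<in>set bs. x \<in> set b"
    and cyc: "\<And>b. b \<in> set bs \<Longrightarrow> map f b = rotate1 b"
    using assms by (auto simp: cycle_decomposition_def)
  have disjoint: "b = b'"
    if "b \<in> set bs" "b' \<in> set bs" "x \<in> set b" "x \<in> set b'" for b b' x
    using \<open>distinct (concat bs)\<close> that unfolding distinct_concat_iff by blast
  have closed: "f x \<in> set b" if "b \<in> set bs" "x \<in> set b" for x b
    using arg_cong[OF cyc[OF that(1)], of set] that(2) by auto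
  have "(\<lambda>S. set (concat S)) ` set (subseqs bs) = (\<lambda>B. \<Union>(set ` B)) ` (set ` set (subseqs bs))"
    by (simp add: image_image)
  also have "\<dots> = (\<lambda>B. \<Union>(set ` B)) ` Pow (set bs)"
    by (simp add: subseqs_powset)
  also have "\<dots> = {X. \<forall>x. f x \<in> X \<longleftrightarrow> x \<in> X}"
  proof (intro subset_antisym subsetI)
    fix X
    assume "X \<in> (\<lambda>B. \<Union>(set ` B)) ` Pow (set bs)"
    then obtain B where B: "B \<subseteq> set bs" "X = \<Union>(set ` B)"
      by blast
    have "f x \<in> X \<longleftrightarrow> x \<in> X" for x
    proof
      assume "f x \<in> X"
      then obtain b where b: "b \<in> B" "f x \<in> set b"
        using B by blast
      obtain b' where b': "b' \<in> set bs" "x \<in> set b'"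
        using cover by blast
      then have "b' = b"
        using disjoint[of b' b "f x"] closed b B by blast
      then show "x \<in> X"
        using B b b' by blast
    qed (use B closed in blast)
    then show "X \<in> {X. \<forall>x. f x \<in> X \<longleftrightarrow> x \<in> X}"
      by blast
  next
    fix X
    assume "X \<in> {X. \<forall>x. f x \<in> X \<longleftrightarrow> x \<in> X}"
    then have inv: "\<And>x. f x \<in> X \<longleftrightarrow> x \<in> X"
      by blast
    have "X \<subseteq> \<Union>(set ` {b \<in> set bs. set b \<subseteq> X})"
    proof
      fix x
      assume "x \<in> X"
      obtain b where "b \<in> set bs" "x \<in> set b"
        using cover by blast
      then show "x \<in> \<Union>(set ` {b \<in> set bs. set b \<subseteq> X})"
        using invariant_set_contains_cycle[OF cyc inv] \<open>x \<in> X\<close> by blast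
    qed
    then show "X \<in> (\<lambda>B. \<Union>(set ` B)) ` Pow (set bs)"
      by (intro image_eqI[of _ _ "{b \<in> set bs. set b \<subseteq> X}"]) auto
  qed
  finally show ?thesis .
qed

lemma distinct_unions_of_blocks:
  assumes "distinct (concat bs)" "[] \<notin> set bs"
  shows "distinct (map (\<lambda>S. set (concat S)) (subseqs bs))"
  using assms
proof (induction bs)
  case (Cons b bs)
  let ?F = "\<lambda>S. set (concat S)"
  have sub: "X \<inter> set b = {}" if X: "X \<in> ?F ` set (subseqs bs)" for X
  proof -
    obtain S where "X = set (concat S)" "S \<in> set (subseqs bs)"
      using X by (rule imageE)
    then have "set S \<in> set ` set (subseqs bs)"
      by blast
    then have "set S \<subseteq> set bs"
      by (simp add: subseqs_powset)
    then show ?thesis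
      using Cons.prems \<open>X = _\<close> by auto
  qed
  have IH: "distinct (map ?F (subseqs bs))"
    using Cons by simp
  have "inj_on (\<lambda>X. set b \<union> X) (?F ` set (subseqs bs))"
    using sub by (intro inj_onI) blast
  then have "distinct (map (\<lambda>X. set b \<union> X) (map ?F (subseqs bs)))"
    using IH by (simp add: distinct_map del: map_map)
  moreover have "set (map (\<lambda>X. set b \<union> X) (map ?F (subseqs bs))) \<inter> set (map ?F (subseqs bs)) = {}"
  proof -
    have "hd b \<in> set b"
      using Cons.prems by auto
    then have "hd b \<in> X" if "X \<in> set (map (\<lambda>X. set b \<union> X) (map ?F (subseqs bs)))" for X
      using that by auto
    moreover have "hd b \<notin> X" if "X \<in> set (map ?F (subseqs bs))" for X
      using sub[of X] that \<open>hd b \<in> set b\<close> by (metis IntI empty_iff set_map)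
    ultimately show ?thesis
      by blast
  qed
  ultimately show ?case
    using IH by (simp add: Let_def comp_def)
qed simp

text \<open>This turns the count of fixed rules into a count over sublists, which can be evaluated.\<close>

lemma card_invariant_sets:
  assumes "cycle_decomposition f bs"
  shows "card {X. (\<forall>x. f x \<in> X \<longleftrightarrow> x \<in> X) \<and> Q X} =
    length (filter (\<lambda>S. Q (set (concat S))) (subseqs bs))"
proof -
  let ?Fs = "map (\<lambda>S. set (concat S)) (subseqs bs)"
  have "distinct ?Fs"
    using assms by (intro distinct_unions_of_blocks) (auto simp: cycle_decomposition_def)
  moreover have "set (filter Q ?Fs) = {X. (\<forall>x. f x \<in> X \<longleftrightarrow> x \<in> X) \<and> Q X}"
    using set_unions_of_cycles[OF assms] by auto
  ultimately have "card {X. (\<forall>x. f x \<in> X \<longleftrightarrow> x \<in> X) \<and> Q X} = length (filter Q ?Fs)"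
    by (metis distinct_card distinct_filter)
  then show ?thesis
    by (simp add: filter_map comp_def)
qed

text \<open>Each cycle is traced for four steps only. An element of \<open>S4\<close> has order at most 4, so this
  reaches every element of its cycles on pairs; that the result is a cycle decomposition for all
  24 permutations is confirmed by evaluation below.\<close>

function cycles :: "('a \<Rightarrow> 'a) \<Rightarrow> 'a list \<Rightarrow> 'a list list" where
  "cycles f [] = []"
| "cycles f (x # xs) =
     (let b = remdups (map (\<lambda>k. (f ^^ k) x) [0..<4])
      in b # cycles f (filter (\<lambda>y. y \<notin> set b) xs))"
  by pat_completeness auto
termination
  by (relation "measure (length \<circ> snd)") (auto simp: less_Suc_eq_le)

definition pair_cycles :: "(step \<Rightarrow> step) \<Rightarrow> (step \<times> step) list list" where
  "pair_cycles g = cycles (map_prod g g) (List.product steps steps)"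

lemma pair_cycles_check:
  "list_all (\<lambda>xs. let f = map_prod (step_table xs) (step_table xs); bs = pair_cycles (step_table xs) in
      distinct (concat bs) \<and> [] \<notin> set bs \<and>
      list_all (\<lambda>e. e \<in> set (concat bs)) (List.product steps steps) \<and>
      list_all (\<lambda>b. map f b = rotate1 b) bs) perms"
  by code_simp

lemma cycle_decomposition_pair_cycles:
  assumes "xs \<in> set perms"
  shows "cycle_decomposition (map_prod (step_table xs) (step_table xs)) (pair_cycles (step_table xs))"
  using pair_cycles_check assms
  by (simp add: list_all_iff Let_def cycle_decomposition_def set_steps)

definition edges :: "('a \<Rightarrow> 'a \<Rightarrow> bool) \<Rightarrow> ('a \<times> 'a) set" where
  "edges R = {(x, y). R x y}"

lemma relabel_eq_iff_edges_invariant: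
  assumes "bij g"
  shows "relabel g R = R \<longleftrightarrow> (\<forall>e. map_prod g g e \<in> edges R \<longleftrightarrow> e \<in> edges R)"
proof -
  have surj: "\<exists>x'. x = g x'" for x
    using assms by (blast elim: bij_pointE)
  have "relabel g R = R \<longleftrightarrow> (\<forall>x y. R (g x) (g y) = R x y)"
  proof
    assume "relabel g R = R"
    then show "\<forall>x y. R (g x) (g y) = R x y"
      using relabel_apply[OF assms, of R] by simp
  next
    assume *: "\<forall>x y. R (g x) (g y) = R x y"
    show "relabel g R = R"
    proof (intro ext)
      fix x y
      obtain x' y' where "x = g x'" "y = g y'"
        using surj by meson
      then show "relabel g R x y = R x y"
        using * by (simp add: relabel_apply[OF assms])
    qed
  qed
  then show ?thesis
    by (auto simp: edges_def)
qed

lemma card_fixed_rules: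
  assumes xs: "xs \<in> set perms" and P: "\<And>R. P R \<longleftrightarrow> Q (edges R)"
  shows "card {R. P R \<and> relabel (step_table xs) R = R} =
    length (filter (\<lambda>S. Q (set (concat S))) (subseqs (pair_cycles (step_table xs))))"
proof -
  let ?f = "map_prod (step_table xs) (step_table xs)"
  have "bij (step_table xs)"
    using xs bij_betw_imp_surj_on[OF bij_betw_step_table_perms] by (auto simp: Bij_UNIV)
  then have fixed: "relabel (step_table xs) R = R \<longleftrightarrow> (\<forall>e. ?f e \<in> edges R \<longleftrightarrow> e \<in> edges R)" for R
    by (rule relabel_eq_iff_edges_invariant)
  have "bij_betw edges {R. P R \<and> relabel (step_table xs) R = R}
      {X. (\<forall>e. ?f e \<in> X \<longleftrightarrow> e \<in> X) \<and> Q X}"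
    by (rule bij_betw_byWitness[where f' = "\<lambda>X x y. (x, y) \<in> X"])
      (auto simp: fixed P, auto simp: edges_def)
  then have "card {R. P R \<and> relabel (step_table xs) R = R} =
      card {X. (\<forall>e. ?f e \<in> X \<longleftrightarrow> e \<in> X) \<and> Q X}"
    by (rule bij_betw_same_card)
  also have "\<dots> = length (filter (\<lambda>S. Q (set (concat S))) (subseqs (pair_cycles (step_table xs))))"
    by (rule card_invariant_sets[OF cycle_decomposition_pair_cycles[OF xs]])
  finally show ?thesis .
qed

section \<open>Connectedness and periodicity as conditions on single edges\<close>

text \<open>A cut is represented by the predicate of crossing it, since the count below only asks
  which cuts a chosen edge settles.\<close>

definition cuts :: "(step \<times> step \<Rightarrow> bool) list" where
  "cuts = map (\<lambda>A (x, y). x \<in> set A \<and> y \<notin> set A)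
     (filter (\<lambda>A. A \<noteq> [] \<and> length A < 4) (subseqs steps))"

text \<open>A colouring is likewise represented by the edges compatible with it. Rotating the residues
  changes the colouring but not this predicate, so each predicate is listed several times; this
  is harmless because only the existence of a compatible colouring matters.\<close>

definition colourings :: "(step \<times> step \<Rightarrow> bool) list" where
  "colourings = concat (map (\<lambda>p. map (\<lambda>c (x, y). step_table c y = Suc (step_table c x) mod p)
     (List.n_lists 4 [0..<p])) [2, 3])"

lemma strongly_connected_iff_cuts:
  "strongly_connected R \<longleftrightarrow> (\<forall>q\<in>set cuts. \<exists>e\<in>edges R. q e)"
proof -
  have "UNIV \<noteq> {x}" for x :: step
  proof
    assume "UNIV = {x}"
    then have "card (UNIV :: step set) = card {x}"
      by (rule arg_cong)
    then show False
      by (simp add: card_step)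
  qed
  then have "strongly_connected R \<longleftrightarrow>
      (\<forall>A. A \<noteq> {} \<longrightarrow> A \<noteq> UNIV \<longrightarrow> (\<exists>x y. R x y \<and> x \<in> A \<and> y \<notin> A))"
    by (rule strongly_connected_iff_no_closed_subset)
  also have "\<dots> \<longleftrightarrow> (\<forall>A\<in>set ` set (subseqs steps). A \<noteq> {} \<longrightarrow> A \<noteq> UNIV \<longrightarrow>
      (\<exists>x y. R x y \<and> x \<in> A \<and> y \<notin> A))"
    by (simp add: subseqs_powset set_steps)
  also have "\<dots> \<longleftrightarrow> (\<forall>A\<in>set (subseqs steps). A \<noteq> [] \<and> length A < 4 \<longrightarrow>
      (\<exists>x y. R x y \<and> x \<in> set A \<and> y \<notin> set A))"
  proof -
    have "set A \<noteq> UNIV \<longleftrightarrow> length A < 4" if "A \<in> set (subseqs steps)" for A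
    proof -
      have "card (set A) = length A"
        using subseqs_distinctD[OF that distinct_steps] by (rule distinct_card)
      moreover have "card (set A) \<le> 4"
        using card_mono[of UNIV "set A"] by (simp add: card_step)
      moreover have "set A = UNIV \<longleftrightarrow> card (set A) = 4"
        using card_subset_eq[of UNIV "set A"] card_step by auto
      ultimately show ?thesis
        by auto
    qed
    then show ?thesis
      by auto
  qed
  also have "\<dots> \<longleftrightarrow> (\<forall>q\<in>set cuts. \<exists>e\<in>edges R. q e)"
    by (auto simp: cuts_def edges_def)
  finally show ?thesis .
qed

text \<open>Only the primes 2 and 3 occur, as there are four steps.\<close>

lemma cyclic_colouring_iff_colourings:
  "(\<exists>p c. prime p \<and> p \<le> card (UNIV :: step set) \<and> cyclic_colouring p c R) \<longleftrightarrow>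
    (\<exists>q\<in>set colourings. \<forall>e\<in>edges R. q e)"
proof -
  have "prime p \<and> p \<le> 4 \<longleftrightarrow> p \<in> {2, 3}" for p :: nat
  proof
    assume "prime p \<and> p \<le> 4"
    moreover have "\<not> prime (4 :: nat)"
      by (simp add: prime_nat_iff') code_simp
    moreover have "p = 0 \<or> p = 1 \<or> p = 2 \<or> p = 3 \<or> p = 4" if "p \<le> 4"
      using that by auto
    ultimately show "p \<in> {2, 3}"
      by auto
  qed auto
  then have "(\<exists>p c. prime p \<and> p \<le> card (UNIV :: step set) \<and> cyclic_colouring p c R) \<longleftrightarrow>
      (\<exists>p\<in>{2, 3}. \<exists>c. cyclic_colouring p c R)"
    unfolding card_step by blast
  also have "\<dots> \<longleftrightarrow> (\<exists>p\<in>{2, 3}. \<exists>c\<in>set (List.n_lists 4 [0..<p]). cyclic_colouring p (step_table c) R)"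
  proof (rule bex_cong[OF refl])
    fix p :: nat
    have "map c steps \<in> set (List.n_lists 4 [0..<p])" if "cyclic_colouring p c R" for c
      using that by (auto simp: set_n_lists cyclic_colouring_def length_steps)
    then show "(\<exists>c. cyclic_colouring p c R) \<longleftrightarrow>
        (\<exists>c\<in>set (List.n_lists 4 [0..<p]). cyclic_colouring p (step_table c) R)"
      by (metis step_table_map_steps)
  qed
  also have "\<dots> \<longleftrightarrow> (\<exists>p\<in>{2, 3}. \<exists>c\<in>set (List.n_lists 4 [0..<p]).
      \<forall>(x, y)\<in>edges R. step_table c y = Suc (step_table c x) mod p)"
  proof (intro bex_cong refl)
    fix p c
    assume c: "c \<in> set (List.n_lists 4 [0..<p])"
    have "step_table c x < p" for x
    proof -
      have "step_table c x \<in> set (map (step_table c) steps)"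
        by (simp add: set_steps)
      moreover have "map (step_table c) steps = c"
        using c by (simp add: set_n_lists map_step_table_steps)
      ultimately have "step_table c x \<in> set c"
        by simp
      then show ?thesis
        using c by (auto simp: set_n_lists)
    qed
    then show "cyclic_colouring p (step_table c) R \<longleftrightarrow>
        (\<forall>(x, y)\<in>edges R. step_table c y = Suc (step_table c x) mod p)"
      by (auto simp: cyclic_colouring_def edges_def)
  qed
  also have "\<dots> \<longleftrightarrow> (\<exists>q\<in>set colourings. \<forall>e\<in>edges R. q e)"
    by (simp add: colourings_def bex_Un)
  finally show ?thesis .
qed

section \<open>Counting unions of cycles\<close>

text \<open>The number of ways to choose cycles from a list so that each predicate in \<open>qs\<close> holds for
  some chosen edge. It decides on the cycles one at a time and keeps only the predicates still
  to be met. The recursion stops as soon as none remains, and it does not branch on a cycle that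
  meets none of them, such as a cycle of loops; this keeps the evaluation small although the
  identity permutation alone fixes \<open>2\<^sup>1\<^sup>6\<close> rules. The values are integers because
  binary numerals evaluate much faster than unary natural numbers.\<close>

fun covering_count :: "('e \<Rightarrow> bool) list \<Rightarrow> 'e list list \<Rightarrow> int" where
  "covering_count qs [] = of_bool (qs = [])"
| "covering_count qs (b # bs) =
    (if qs = [] then 2 ^ length (b # bs)
     else let qs' = filter (\<lambda>q. \<not> list_ex q b) qs
       in if length qs' = length qs then 2 * covering_count qs bs
          else covering_count qs bs + covering_count qs' bs)"

text \<open>Here the chosen edges must moreover all satisfy one common predicate from \<open>cs\<close>. The list
  \<open>cs\<close> keeps the predicates that have survived so far, and a branch is dropped when it becomes
  empty. This happens at once when a loop is chosen, since a loop cannot change colour.\<close>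

fun coloured_count :: "('e \<Rightarrow> bool) list \<Rightarrow> ('e \<Rightarrow> bool) list \<Rightarrow> 'e list list \<Rightarrow> int" where
  "coloured_count qs cs [] = of_bool (qs = [] \<and> cs \<noteq> [])"
| "coloured_count qs cs (b # bs) =
    (if cs = [] then 0
     else coloured_count qs cs bs +
       coloured_count (filter (\<lambda>q. \<not> list_ex q b) qs) (filter (\<lambda>c. list_all c b) cs) bs)"

lemma length_filter_subseqs_Cons:
  "length (filter P (subseqs (b # bs))) =
    length (filter (\<lambda>S. P (b # S)) (subseqs bs)) + length (filter P (subseqs bs))"
  by (simp add: Let_def filter_map comp_def)

lemma covering_count_eq:
  "covering_count qs bs =
    int (length (filter (\<lambda>S. \<forall>q\<in>set qs. list_ex q (concat S)) (subseqs bs)))"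
proof (induction qs bs rule: covering_count.induct)
  case (1 qs)
  then show ?case by (cases qs) auto
next
  case (2 qs b bs)
  let ?qs' = "filter (\<lambda>q. \<not> list_ex q b) qs"
  have choose: "(\<forall>q\<in>set qs. list_ex q (concat (b # S))) \<longleftrightarrow>
      (\<forall>q\<in>set ?qs'. list_ex q (concat S))" for S
    by auto
  have eq: "?qs' = qs" if "length ?qs' = length qs"
    using that by (metis length_filter_less less_irrefl filter_True)
  show ?case
  proof (cases "qs = []")
    case True
    then show ?thesis
      by (simp add: length_subseqs del: subseqs.simps)
  next
    case False
    then have "covering_count qs (b # bs) = covering_count qs bs + covering_count ?qs' bs"
      using eq by (auto simp: Let_def)
    moreover have "covering_count ?qs' bs =
        int (length (filter (\<lambda>S. \<forall>q\<in>set ?qs'. list_ex q (concat S)) (subseqs bs)))"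
      using 2 False eq by (cases "length ?qs' = length qs") auto
    moreover have "covering_count qs bs =
        int (length (filter (\<lambda>S. \<forall>q\<in>set qs. list_ex q (concat S)) (subseqs bs)))"
      using 2 False by (cases "length ?qs' = length qs") auto
    ultimately show ?thesis
      unfolding length_filter_subseqs_Cons choose by simp
  qed
qed

lemma coloured_count_eq:
  "coloured_count qs cs bs =
    int (length (filter (\<lambda>S. (\<forall>q\<in>set qs. list_ex q (concat S)) \<and>
      (\<exists>c\<in>set cs. list_all c (concat S))) (subseqs bs)))"
proof (induction qs cs bs rule: coloured_count.induct)
  case (1 qs cs)
  then show ?case by (cases qs; cases cs) auto
next
  case (2 qs cs b bs)
  let ?qs' = "filter (\<lambda>q. \<not> list_ex q b) qs" and ?cs' = "filter (\<lambda>c. list_all c b) cs"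
  have choose: "(\<forall>q\<in>set qs. list_ex q (concat (b # S))) \<longleftrightarrow>
      (\<forall>q\<in>set ?qs'. list_ex q (concat S))"
      "(\<exists>c\<in>set cs. list_all c (concat (b # S))) \<longleftrightarrow>
      (\<exists>c\<in>set ?cs'. list_all c (concat S))" for S
    by auto
  show ?case
  proof (cases "cs = []")
    case False
    then show ?thesis
      unfolding length_filter_subseqs_Cons choose using 2 by simp
  qed simp
qed

section \<open>The numbers of classes\<close>

lemma sum_covering_count:
  "(\<Sum>xs\<leftarrow>perms. covering_count cuts (pair_cycles (step_table xs))) = 28032"
  by code_simp

lemma sum_coloured_count:
  "(\<Sum>xs\<leftarrow>perms. coloured_count cuts colourings (pair_cycles (step_table xs))) = 216"
  by code_simp

lemma sum_power_cycles:
  "(\<Sum>xs\<leftarrow>perms. 2 ^ length (pair_cycles (step_table xs)) :: int) = 73056"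
  by code_simp

lemma card_fixed_connected:
  assumes "xs \<in> set perms"
  shows "int (card {R. strongly_connected R \<and> relabel (step_table xs) R = R}) =
    covering_count cuts (pair_cycles (step_table xs))"
  using card_fixed_rules[OF assms, of strongly_connected "\<lambda>X. \<forall>q\<in>set cuts. \<exists>e\<in>X. q e",
      OF strongly_connected_iff_cuts]
  by (simp add: covering_count_eq list_ex_iff)

text \<open>The rules that are connected but periodic are few and are recognised edge by edge; the
  fixed aperiodic rules are counted as the difference.\<close>

lemma card_fixed_periodic:
  assumes "xs \<in> set perms"
  shows "int (card {R. (strongly_connected R \<and> \<not> primitive_rel R) \<and> relabel (step_table xs) R = R}) =
    coloured_count cuts colourings (pair_cycles (step_table xs))"
proof -
  have "strongly_connected R \<and> \<not> primitive_rel R \<longleftrightarrow>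
      (\<forall>q\<in>set cuts. \<exists>e\<in>edges R. q e) \<and> (\<exists>q\<in>set colourings. \<forall>e\<in>edges R. q e)" for R
    using primitive_iff_no_cyclic_colouring[of R] strongly_connected_iff_cuts[of R]
      cyclic_colouring_iff_colourings[of R] by blast
  from card_fixed_rules[OF assms, of "\<lambda>R. strongly_connected R \<and> \<not> primitive_rel R"
      "\<lambda>X. (\<forall>q\<in>set cuts. \<exists>e\<in>X. q e) \<and> (\<exists>q\<in>set colourings. \<forall>e\<in>X. q e)",
      OF this]
  show ?thesis
    by (simp add: coloured_count_eq list_ex_iff list_all_iff)
qed

lemma num_classes_all: "num_classes all_rules = 3044"
proof -
  have "int (card {R. relabel (step_table xs) R = R}) = 2 ^ length (pair_cycles (step_table xs))"
    if "xs \<in> set perms" for xs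
    using card_fixed_rules[OF that, of "\<lambda>_. True" "\<lambda>_. True"] by (simp add: length_subseqs)
  then have "24 * int (num_classes all_rules) = 73056"
    unfolding num_classes_burnside[OF group_action_all] sum_power_cycles[symmetric]
    by (simp add: all_rules_def cong: map_cong)
  then show ?thesis by simp
qed

lemma num_classes_connected: "num_classes connected_rules = 1168"
proof -
  have "24 * int (num_classes connected_rules) = 28032"
    unfolding num_classes_burnside[OF group_action_connected] sum_covering_count[symmetric]
    by (simp add: connected_rules_def connected_rule_iff card_fixed_connected cong: map_cong)
  then show ?thesis by simp
qed

lemma num_classes_aperiodic: "num_classes aperiodic_rules = 1159"
proof -
  have "int (card {R. primitive_rel R \<and> relabel (step_table xs) R = R}) =
      covering_count cuts (pair_cycles (step_table xs)) -
      coloured_count cuts colourings (pair_cycles (step_table xs))" if "xs \<in> set perms" for xs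
  proof -
    have "{R. strongly_connected R \<and> relabel (step_table xs) R = R} =
        {R. primitive_rel R \<and> relabel (step_table xs) R = R} \<union>
        {R. (strongly_connected R \<and> \<not> primitive_rel R) \<and> relabel (step_table xs) R = R}"
      using primitive_iff_no_cyclic_colouring by blast
    then have "card {R. strongly_connected R \<and> relabel (step_table xs) R = R} =
        card {R. primitive_rel R \<and> relabel (step_table xs) R = R} +
        card {R. (strongly_connected R \<and> \<not> primitive_rel R) \<and> relabel (step_table xs) R = R}"
      by (simp only:) (rule card_Un_disjoint, auto)
    then show ?thesis
      using card_fixed_connected[OF that] card_fixed_periodic[OF that] by simp
  qed
  then have "24 * int (num_classes aperiodic_rules) =
      (\<Sum>xs\<leftarrow>perms. covering_count cuts (pair_cycles (step_table xs)) -
        coloured_count cuts colourings (pair_cycles (step_table xs)))"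
    unfolding num_classes_burnside[OF group_action_aperiodic]
    by (simp add: aperiodic_rules_def aperiodic_rule_iff cong: map_cong)
  then have "24 * int (num_classes aperiodic_rules) = 28032 - 216"
    unfolding sum_list_subtractf sum_covering_count sum_coloured_count .
  then show ?thesis by simp
qed

theorem lemma3:
  shows "group_action S4 all_rules (relabel_on all_rules) \<and>
    group_action S4 connected_rules (relabel_on connected_rules) \<and>
    group_action S4 aperiodic_rules (relabel_on aperiodic_rules) \<and>
    num_classes all_rules = 3044 \<and>
    num_classes connected_rules = 1168 \<and>
    num_classes aperiodic_rules = 1159"
  using group_action_all group_action_connected group_action_aperiodic
    num_classes_all num_classes_connected num_classes_aperiodic by blast

end
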